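(* Let $s,t$ be positive integers, put $q=s-1$ and $r=s+t-1$, and let $u_{-1}=1/s$, $u_0=1$, $u_n=ru_{n-1}+su_{n-2}$ for $n\ge1$. Every nonnegative integer $m$ has a unique representation $R(m)=\sum_{i=0}^{n}d_iu_i$ with digits $d_i\in\{0,\dots,r\}$ satisfying $d_{i+1}=r\implies d_i\le q$ for all $i\ge0$. Let $0=V_0<V_1<V_2<\cdots$ be the increasing enumeration of all evil numbers, and for each $n\ge0$ let $W_n$ be the integer with $R(W_n)=LR(V_n)$. Define $(A_n)_{n\ge0}$, $(B_n)_{n\ge0}$ by $A_n=\operatorname{mex}\{A_i,B_i:0\le i<n\}$ and $B_n=sA_n+tn$. Then $(V_n,W_n)=(A_n,B_n)$ for all $n\ge0$.
   Context: A positive integer $m$ is evil if its representation $R(m)$ ends in an even number (possibly zero) of zero digits, i.e. the least index $i$ with $d_i\neq 0$ is even; it is old if that number is odd; by convention $0$ is both evil and old. The left shift of $R(m)=\sum_{i=0}^{n}d_iu_i$ is $LR(m)=\sum_{i=0}^{n}d_iu_{i+1}$. For a finite set $S$ of nonnegative integers, $\operatorname{mex} S$ is the least nonnegative integer not in $S$. *)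

theory Defs
  imports Complex_Main "HOL-Library.Infinite_Set"
begin

text \<open>
  A representation is a digit sequence indexed by all of \<open>nat\<close> with finite support,
  so that representations differing only in leading zeros are identified.
  The weights \<open>u\<close> are indexed by \<open>int\<close> (and real-valued) because the recurrence
  starts from \<open>u (-1) = 1/s\<close>.
\<close>

definition represents :: "nat \<Rightarrow> nat \<Rightarrow> (int \<Rightarrow> real) \<Rightarrow> (nat \<Rightarrow> nat) \<Rightarrow> nat \<Rightarrow> bool" where
  "represents q r u d m \<longleftrightarrow>
     finite {i. d i \<noteq> 0} \<and>
     (\<forall>i. d i \<le> r) \<and>
     (\<forall>i. d (i + 1) = r \<longrightarrow> d i \<le> q) \<and>
     real m = (\<Sum>i | d i \<noteq> 0. real (d i) * u (int i))"

definition R :: "nat \<Rightarrow> nat \<Rightarrow> (int \<Rightarrow> real) \<Rightarrow> nat \<Rightarrow> (nat \<Rightarrow> nat)" where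
  "R q r u m = (THE d. represents q r u d m)"

definition LR :: "nat \<Rightarrow> nat \<Rightarrow> (int \<Rightarrow> real) \<Rightarrow> nat \<Rightarrow> (nat \<Rightarrow> nat)" where
  "LR q r u m = (\<lambda>i. if i = 0 then 0 else R q r u m (i - 1))"

definition evil :: "nat \<Rightarrow> nat \<Rightarrow> (int \<Rightarrow> real) \<Rightarrow> nat \<Rightarrow> bool" where
  "evil q r u m \<longleftrightarrow> m = 0 \<or> even (LEAST i. R q r u m i \<noteq> 0)"

definition mex :: "nat set \<Rightarrow> nat" where
  "mex S = (LEAST n. n \<notin> S)"

end

theory Submission
  imports Defs
begin

text \<open>
  Let \<open>k\<close> be the lowest position of a nonzero digit of \<open>m + 1\<close>. Then the digits of \<open>m\<close> arise
  by decreasing that digit by one and filling the positions below \<open>k\<close> with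
  \<open>r, q, r, q, \<dots>\<close> from the top, because this is the representation of \<open>u\<^sub>k - 1\<close>. Two facts can
  be read off. If \<open>m + 1\<close> is old then \<open>m\<close> ends in \<open>r\<close>, hence is evil; and the left shift
  grows from \<open>m\<close> to \<open>m + 1\<close> by \<open>s + t\<close> if \<open>m + 1\<close> is evil and by \<open>s\<close> if it is old.
  Summing up, the left shift of an evil \<open>m\<close> is \<open>s m + t n\<close>, where \<open>n\<close> is the number of evil
  numbers below \<open>m\<close>, so that \<open>W\<^sub>n = s V\<^sub>n + t n\<close>. As the left shift maps the positive evil
  numbers onto the positive old ones, \<open>V\<close> and \<open>W\<close> are complementary and \<open>V\<close> satisfies the mex
  recursion.
\<close>

section \<open>Weights and values of digit sequences\<close>

fun weight :: "nat \<Rightarrow> nat \<Rightarrow> nat \<Rightarrow> nat" where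
  "weight s t 0 = 1"
| "weight s t (Suc 0) = s + t"
| "weight s t (Suc (Suc n)) = (s + t - 1) * weight s t (Suc n) + s * weight s t n"

text \<open>The weights are a parameter because the same digits are evaluated both with
  \<open>weight s t\<close> and with its shift by one index.\<close>

definition digit_value :: "(nat \<Rightarrow> nat) \<Rightarrow> (nat \<Rightarrow> nat) \<Rightarrow> nat" where
  "digit_value w d = (\<Sum>i | d i \<noteq> 0. d i * w i)"

lemma digit_value_eq_sum:
  assumes "\<And>i. i \<ge> n \<Longrightarrow> d i = 0"
  shows "digit_value w d = (\<Sum>i<n. d i * w i)"
  unfolding digit_value_def
proof (rule sum.mono_neutral_left)
  show "{i. d i \<noteq> 0} \<subseteq> {..<n}"
  proof
    fix i assume "i \<in> {i. d i \<noteq> 0}"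
    then show "i \<in> {..<n}" using assms[of i] by (cases "n \<le> i") simp_all
  qed
qed auto

lemma finite_support_bound:
  fixes d :: "nat \<Rightarrow> nat"
  assumes "finite {i. d i \<noteq> 0}"
  obtains n where "\<And>i. i \<ge> n \<Longrightarrow> d i = 0"
proof -
  obtain n where "\<forall>i\<in>{i. d i \<noteq> 0}. i < n"
    using assms finite_nat_set_iff_bounded by blast
  then show thesis using that by (metis (mono_tags) mem_Collect_eq not_le)
qed

lemma finite_supportI:
  fixes d :: "nat \<Rightarrow> nat"
  assumes "\<And>i. i \<ge> n \<Longrightarrow> d i = 0"
  shows "finite {i. d i \<noteq> 0}"
proof (rule finite_subset)
  show "{i. d i \<noteq> 0} \<subseteq> {..<n}"
  proof
    fix i assume "i \<in> {i. d i \<noteq> 0}"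
    then show "i \<in> {..<n}" using assms[of i] by (cases "n \<le> i") simp_all
  qed
qed simp

lemma enumerate_card_less:
  fixes S :: "nat set"
  assumes "infinite S"
  shows "card {k \<in> S. k < enumerate S n} = n"
proof -
  have "{k \<in> S. k < enumerate S n} = enumerate S ` {..<n}"
  proof (intro equalityI subsetI)
    fix k assume k: "k \<in> {k \<in> S. k < enumerate S n}"
    then obtain i where "enumerate S i = k"
      using enumerate_Ex[OF assms, of k] by auto
    then show "k \<in> enumerate S ` {..<n}"
      using k enumerate_mono_iff[OF assms, of i n] by auto
  qed (use enumerate_mono_iff[OF assms] enumerate_in_set[OF assms] in auto)
  moreover have "inj_on (enumerate S) {..<n}"
    using inj_enumerate[OF assms] by (rule inj_on_subset) simp
  ultimately show ?thesis by (simp add: card_image)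
qed

section \<open>Existence and uniqueness of representations\<close>

locale numeration =
  fixes s t :: nat
  assumes s_pos: "s > 0" and t_pos: "t > 0"
begin

definition q :: nat where "q = s - 1"
definition r :: nat where "r = s + t - 1"
abbreviation U :: "nat \<Rightarrow> nat" where "U \<equiv> weight s t"

definition admissible :: "(nat \<Rightarrow> nat) \<Rightarrow> bool" where
  "admissible d \<longleftrightarrow> finite {i. d i \<noteq> 0} \<and> (\<forall>i. d i \<le> r) \<and> (\<forall>i. d (Suc i) = r \<longrightarrow> d i \<le> q)"

definition rep :: "(nat \<Rightarrow> nat) \<Rightarrow> nat \<Rightarrow> bool" where
  "rep d m \<longleftrightarrow> admissible d \<and> digit_value U d = m"

lemma U_pos: "U n > 0"
  using s_pos by (induction n rule: induct_nat_012) auto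

lemma Suc_q: "Suc q = s" and Suc_r: "Suc r = s + t" and q_less_r: "q < r"
  using s_pos t_pos by (auto simp: q_def r_def)

lemma U_Suc_Suc: "U (Suc (Suc n)) = r * U (Suc n) + s * U n"
  by (simp add: r_def)

declare weight.simps(3) [simp del] U_Suc_Suc [simp]

lemma U_ge: "s * U n + 1 \<le> U (Suc n)"
proof (cases n)
  case (Suc k)
  have "s * U n \<le> r * U n" using t_pos by (intro mult_le_mono1) (simp add: r_def)
  moreover have "0 < s * U k" using s_pos U_pos by simp
  ultimately show ?thesis unfolding Suc U_Suc_Suc by linarith
qed (use t_pos in simp)

text \<open>A top digit \<open>r\<close> forces the next digit to be at most \<open>s - 1\<close>,
  so the recurrence leaves a full \<open>U k\<close> for the digits below; a smaller top digit
  leaves a full \<open>U (Suc k)\<close>.\<close>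

lemma admissible_sum_less:
  assumes "admissible d"
  shows "(\<Sum>i<n. d i * U i) < U n"
proof (induction n rule: less_induct)
  case (less n)
  consider "n = 0" | "n = 1" | k where "n = Suc (Suc k)"
    by (metis One_nat_def old.nat.exhaust)
  then show ?case
  proof cases
    case 2
    have "d 0 \<le> r" using assms by (simp add: admissible_def)
    then show ?thesis using 2 Suc_r by simp
  next
    case (3 k)
    show ?thesis
    proof (cases "d (Suc k) = r")
      case True
      then have "d k \<le> q" using assms by (simp add: admissible_def)
      then have "d k * U k + U k \<le> s * U k"
        by (metis Suc_q Suc_le_mono add.commute mult_Suc mult_le_mono1)
      then show ?thesis using 3 True less[of k] by simp
    next
      case False
      then have "d (Suc k) < r" using assms by (simp add: admissible_def le_neq_trans)
      then have "d (Suc k) * U (Suc k) + U (Suc k) \<le> r * U (Suc k)"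
        by (metis Suc_leI add.commute mult_Suc mult_le_mono1)
      then show ?thesis using 3 less[of "Suc k"] by simp
    qed
  qed simp
qed

text \<open>The lower digits contribute less than \<open>U n\<close>, so the top digit is the
  quotient by \<open>U n\<close>; the others follow by descent.\<close>

lemma admissible_sum_inject:
  assumes "admissible d" "admissible e"
    and "(\<Sum>i<n. d i * U i) = (\<Sum>i<n. e i * U i)" "i < n"
  shows "d i = e i"
  using assms(3,4)
proof (induction n)
  case (Suc n)
  have lt: "(\<Sum>i<n. d i * U i) < U n" "(\<Sum>i<n. e i * U i) < U n"
    using assms(1,2) admissible_sum_less by auto
  have eq: "(\<Sum>i<n. d i * U i) + d n * U n = (\<Sum>i<n. e i * U i) + e n * U n"
    using Suc.prems(1) by simp
  have "d n = e n"
    using arg_cong[OF eq, of "\<lambda>x. x div U n"] lt U_pos[of n] by simp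
  then show ?case using Suc eq by (cases "i = n") auto
qed simp

lemma rep_unique:
  assumes "rep d m" "rep e m"
  shows "d = e"
proof
  fix i
  obtain a where a: "\<And>i. i \<ge> a \<Longrightarrow> d i = 0"
    using assms finite_support_bound unfolding rep_def admissible_def by metis
  obtain b where b: "\<And>i. i \<ge> b \<Longrightarrow> e i = 0"
    using assms finite_support_bound unfolding rep_def admissible_def by metis
  define n where "n = a + b + Suc i"
  have "(\<Sum>i<n. d i * U i) = m" "(\<Sum>i<n. e i * U i) = m"
    using assms digit_value_eq_sum[of n d U] digit_value_eq_sum[of n e U] a b
    by (auto simp: n_def rep_def)
  then show "d i = e i"
    using assms admissible_sum_inject[of d e n i] by (simp add: rep_def n_def)
qed

text \<open>Greedy expansion: the top digit is the quotient by \<open>U n\<close>, and the remainder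
  supplies the lower digits.\<close>

lemma rep_exists_below:
  assumes "m < U n"
  shows "\<exists>d. admissible d \<and> (\<forall>i\<ge>n. d i = 0) \<and> (\<Sum>i<n. d i * U i) = m"
  using assms
proof (induction n arbitrary: m)
  case 0
  then show ?case using q_less_r by (intro exI[of _ "\<lambda>_. 0"]) (auto simp: admissible_def)
next
  case (Suc n)
  define a where "a = m div U n"
  obtain d where d: "admissible d" "\<And>i. i \<ge> n \<Longrightarrow> d i = 0" "(\<Sum>i<n. d i * U i) = m mod U n"
    using Suc.IH[of "m mod U n"] U_pos[of n] by auto
  have m: "m = a * U n + m mod U n" by (simp add: a_def)
  \<comment> \<open>This bound keeps the greedy digit \<open>a\<close> within
    \<open>r\<close>.\<close>
  have "U (Suc n) \<le> Suc r * U n"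
  proof (cases n)
    case (Suc k)
    then have "U (Suc n) = r * U n + s * U k" by simp
    moreover have "s * U k \<le> U n" using U_ge[of k] Suc by simp
    ultimately show ?thesis unfolding mult_Suc by linarith
  qed (simp add: Suc_r)
  then have "m < Suc r * U n" using Suc.prems by (rule less_le_trans[rotated])
  then have "a < Suc r" unfolding a_def by (rule less_mult_imp_div_less)
  then have a_le: "a \<le> r" by (rule less_Suc_eq_le[THEN iffD1])
  \<comment> \<open>After a top digit \<open>r\<close>, less than \<open>s * U k\<close> remains of
    \<open>m\<close>, so the next digit is below \<open>s\<close>.\<close>
  have top: "d k \<le> q" if "a = r" "n = Suc k" for k
  proof -
    have "d k * U k \<le> (\<Sum>i<n. d i * U i)" unfolding that(2) by simp
    also have "\<dots> < s * U k"
    proof -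
      have "m = r * U n + (\<Sum>i<n. d i * U i)" using m d(3) that(1) by simp
      moreover have "m < r * U n + s * U k" using Suc.prems unfolding that(2) U_Suc_Suc .
      ultimately show ?thesis by linarith
    qed
    finally have "d k < s" by simp
    then show ?thesis using Suc_q by simp
  qed
  let ?d = "d(n := a)"
  have "admissible ?d"
    unfolding admissible_def
  proof (intro conjI allI impI)
    show "finite {i. ?d i \<noteq> 0}"
      by (rule finite_supportI[of "Suc n"]) (use d(2) in auto)
    show "?d i \<le> r" for i using d(1) a_le by (auto simp: admissible_def)
    show "?d i \<le> q" if "?d (Suc i) = r" for i
    proof -
      consider "Suc i = n" | "i = n" | "Suc i \<noteq> n" "i \<noteq> n" by blast
      then show ?thesis
      proof cases
        case 1
        then show ?thesis using that top[of i] by simp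
      next
        \<comment> \<open>The digit above the new top one is 0, hence not \<open>r\<close>, since
          \<open>r > q\<close>.\<close>
        case 2
        then show ?thesis using that d(2)[of "Suc n"] q_less_r by simp
      next
        case 3
        then show ?thesis using that d(1) by (simp add: admissible_def)
      qed
    qed
  qed
  moreover have "(\<Sum>i<Suc n. ?d i * U i) = m"
    using d(3) m by simp
  moreover have "\<forall>i\<ge>Suc n. ?d i = 0" using d(2) by simp
  ultimately show ?case by blast
qed

text \<open>This makes \<open>m\<close> itself a sufficient number of digits for representing
  \<open>m\<close>.\<close>

lemma less_U: "n < U n"
proof (induction n)
  case (Suc n)
  moreover have "U n \<le> s * U n" using s_pos by simp
  ultimately show ?case using U_ge[of n] by linarith
qed simp

lemma ex1_rep: "\<exists>!d. rep d m"
proof -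
  obtain d where "admissible d" "\<forall>i\<ge>m. d i = 0" "(\<Sum>i<m. d i * U i) = m"
    using rep_exists_below[OF less_U] by blast
  then have "rep d m" using digit_value_eq_sum[of m d U] by (simp add: rep_def)
  then show ?thesis using rep_unique by blast
qed

definition digits :: "nat \<Rightarrow> nat \<Rightarrow> nat" where
  "digits m = (THE d. rep d m)"

lemma rep_digits: "rep (digits m) m"
  unfolding digits_def by (rule theI'[OF ex1_rep])

lemma digits_eqI: "rep d m \<Longrightarrow> digits m = d"
  by (rule rep_unique[OF rep_digits])

lemma digits_inject: "digits m = digits n \<Longrightarrow> m = n"
  using rep_digits[of m] rep_digits[of n] by (simp add: rep_def)

lemma digits_0: "digits 0 = (\<lambda>_. 0)"
  by (rule digits_eqI) (use q_less_r in \<open>auto simp: rep_def admissible_def digit_value_def\<close>)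

lemma digits_eq_0_iff: "digits m = (\<lambda>_. 0) \<longleftrightarrow> m = 0"
  using digits_inject[of m 0] by (auto simp: digits_0)

definition is_evil :: "nat \<Rightarrow> bool" where
  "is_evil m \<longleftrightarrow> m = 0 \<or> even (LEAST i. digits m i \<noteq> 0)"

definition shift :: "nat \<Rightarrow> nat" where
  "shift m = digit_value (\<lambda>i. U (Suc i)) (digits m)"

section \<open>Subtracting one from a representation\<close>

text \<open>The digits at \<open>i < k\<close> of the largest number with \<open>k\<close> digits; the top digit is \<open>r\<close>.\<close>

definition max_digit :: "nat \<Rightarrow> nat \<Rightarrow> nat" where
  "max_digit k i = (if even (k + i) then q else r)"

text \<open>Raising \<open>k\<close> by two preserves the parity of \<open>k + i\<close>, so the old
  digits stay and \<open>q\<close>, \<open>r\<close> are appended on top. This drives the two-step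
  inductions below.\<close>

lemma max_digit_sum_Suc_Suc:
  "(\<Sum>i<Suc (Suc k). max_digit (Suc (Suc k)) i * w i)
     = (\<Sum>i<k. max_digit k i * w i) + q * w k + r * w (Suc k)"
  by (simp add: max_digit_def)

lemma max_digit_sum_U: "(\<Sum>i<k. max_digit k i * U i) + 1 = U k"
proof (induction k rule: induct_nat_012)
  case (ge2 k)
  have "q * U k + U k = s * U k" by (metis Suc_q add.commute mult_Suc)
  then show ?case unfolding max_digit_sum_Suc_Suc U_Suc_Suc using ge2(1) by linarith
qed (use Suc_r in \<open>auto simp: max_digit_def\<close>)

text \<open>Since \<open>q + 1 = s\<close>, a step by two preserves the defect from
  \<open>U (Suc k)\<close>. It is therefore fixed by the base cases: \<open>U 1 = s + t\<close> for
  \<open>k = 0\<close>, and \<open>U 2 - r * U 1 = s\<close> for \<open>k = 1\<close>.\<close>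

lemma max_digit_sum_U_Suc:
  "(\<Sum>i<k. max_digit k i * U (Suc i)) + (if even k then s + t else s) = U (Suc k)"
proof (induction k rule: induct_nat_012)
  case (ge2 k)
  have "q * U (Suc k) + U (Suc k) = s * U (Suc k)" by (metis Suc_q add.commute mult_Suc)
  then show ?case
    unfolding max_digit_sum_Suc_Suc U_Suc_Suc[of "Suc k"] even_Suc_Suc_iff
    using ge2(1) by linarith
qed (auto simp: max_digit_def)

definition pred_digits :: "nat \<Rightarrow> (nat \<Rightarrow> nat) \<Rightarrow> nat \<Rightarrow> nat" where
  "pred_digits k d i = (if i < k then max_digit k i else if i = k then d k - 1 else d i)"

lemma digit_value_pred_digits:
  assumes "finite {i. d i \<noteq> 0}" "d k \<noteq> 0" "\<And>i. i < k \<Longrightarrow> d i = 0"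
  shows "digit_value w (pred_digits k d) + w k = digit_value w d + (\<Sum>i<k. max_digit k i * w i)"
proof -
  obtain n where n: "\<And>i. i \<ge> n \<Longrightarrow> d i = 0"
    using assms(1) finite_support_bound by blast
  have "k < n" using n[of k] assms(2) by (cases "n \<le> k") simp_all
  have split: "(\<Sum>i<n. f i) = (\<Sum>i<k. f i) + f k + (\<Sum>i\<in>{Suc k..<n}. f i)" for f :: "nat \<Rightarrow> nat"
    using sum.atLeastLessThan_concat[of 0 "Suc k" n f] \<open>k < n\<close> by (simp add: atLeast0LessThan)
  have "digit_value w (pred_digits k d) = (\<Sum>i<n. pred_digits k d i * w i)"
    by (rule digit_value_eq_sum) (use n \<open>k < n\<close> in \<open>auto simp: pred_digits_def\<close>)
  also have "\<dots> = (\<Sum>i<k. max_digit k i * w i) + (d k - 1) * w k + (\<Sum>i\<in>{Suc k..<n}. d i * w i)"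
    unfolding split by (simp add: pred_digits_def)
  finally have 1: "digit_value w (pred_digits k d) = \<dots>" .
  have "digit_value w d = (\<Sum>i<n. d i * w i)"
    by (rule digit_value_eq_sum) (use n in auto)
  also have "\<dots> = d k * w k + (\<Sum>i\<in>{Suc k..<n}. d i * w i)"
    unfolding split using assms(3) by simp
  finally have 2: "digit_value w d = \<dots>" .
  have "(d k - 1) * w k + w k = d k * w k"
    using assms(2) by (cases "d k") auto
  then show ?thesis using 1 2 by linarith
qed

lemma admissible_pred_digits:
  assumes "admissible d" "d k \<noteq> 0"
  shows "admissible (pred_digits k d)"
  unfolding admissible_def
proof (intro conjI allI impI)
  obtain n where n: "\<And>i. i \<ge> n \<Longrightarrow> d i = 0"
    using assms(1) finite_support_bound unfolding admissible_def by blast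
  show "finite {i. pred_digits k d i \<noteq> 0}"
    by (rule finite_supportI[of "Suc (n + k)"]) (use n in \<open>auto simp: pred_digits_def\<close>)
  have le: "d i \<le> r" and le': "d (Suc i) = r \<Longrightarrow> d i \<le> q" for i
    using assms by (auto simp: admissible_def)
  show "pred_digits k d i \<le> r" for i
    using le[of i] q_less_r by (auto simp: pred_digits_def max_digit_def)
  show "pred_digits k d i \<le> q" if "pred_digits k d (Suc i) = r" for i
  proof -
    consider "Suc i < k" | "Suc i = k" | "i = k" | "i > k" by linarith
    then show ?thesis
    proof cases
      \<comment> \<open>The filler meets the lowered digit here: \<open>d k - 1\<close> is below
        \<open>r\<close>, so the premise is impossible.\<close>
      case 2
      then show ?thesis using that le[of k] assms(2) by (simp add: pred_digits_def)
    qed (use that q_less_r le'[of i] in \<open>auto simp: pred_digits_def max_digit_def split: if_splits\<close>)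
  qed
qed

text \<open>Evaluating the same change of digits with the weights \<open>U\<close> identifies the
  predecessor; evaluating it with the shifted weights gives the growth of
  \<open>shift\<close>.\<close>

lemma digits_pred:
  fixes m :: nat
  defines "k \<equiv> LEAST i. digits (Suc m) i \<noteq> 0"
  shows "digits m = pred_digits k (digits (Suc m))"
    and "shift (Suc m) = shift m + (if even k then s + t else s)"
proof -
  let ?d = "digits (Suc m)"
  have "\<exists>i. ?d i \<noteq> 0" using digits_eq_0_iff[of "Suc m"] by auto
  then have k: "?d k \<noteq> 0" unfolding k_def by (rule LeastI_ex)
  have below: "?d i = 0" if "i < k" for i
    using that not_less_Least unfolding k_def by blast
  have adm: "admissible ?d" and val: "digit_value U ?d = Suc m"
    using rep_digits unfolding rep_def by auto
  have fin: "finite {i. ?d i \<noteq> 0}" using adm by (simp add: admissible_def)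
  have "rep (pred_digits k ?d) m"
    using admissible_pred_digits[OF adm k] digit_value_pred_digits[OF fin k below, of U]
      max_digit_sum_U[of k] val by (simp add: rep_def)
  then show eq: "digits m = pred_digits k ?d" by (rule digits_eqI)
  show "shift (Suc m) = shift m + (if even k then s + t else s)"
    using digit_value_pred_digits[OF fin k below, of "\<lambda>i. U (Suc i)"] max_digit_sum_U_Suc[of k]
    unfolding shift_def eq by linarith
qed

section \<open>Growth of the left shift and counting of evil numbers\<close>

lemma shift_Suc: "shift (Suc m) = shift m + (if is_evil (Suc m) then s + t else s)"
  using digits_pred(2)[of m] by (simp add: is_evil_def)

lemma is_evil_or_is_evil_Suc: "is_evil m \<or> is_evil (Suc m)"
proof (rule disjCI)
  let ?k = "LEAST i. digits (Suc m) i \<noteq> 0"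
  assume "\<not> is_evil (Suc m)"
  then have "odd ?k" by (simp add: is_evil_def)
  \<comment> \<open>An odd \<open>?k\<close> is positive and has odd distance to position 0, so the
    filler digit there is \<open>r\<close>.\<close>
  then have "digits m 0 = r"
    using digits_pred(1)[of m] by (auto simp: pred_digits_def max_digit_def elim: oddE)
  then have "(LEAST i. digits m i \<noteq> 0) = 0"
    using q_less_r by (intro Least_eq_0) simp
  then show "is_evil m" by (simp add: is_evil_def)
qed

lemma infinite_evil: "infinite {m. is_evil m}"
  unfolding infinite_nat_iff_unbounded_le
proof
  fix m
  show "\<exists>n\<ge>m. n \<in> {m. is_evil m}"
    using is_evil_or_is_evil_Suc[of m] by (auto intro: exI[of _ m] exI[of _ "Suc m"])
qed

text \<open>The correction \<open>t\<close> for old \<open>m\<close> makes the induction on \<open>m\<close> go through.\<close>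

lemma shift_eq_card:
  "shift m + (if is_evil m then 0 else t) = s * m + t * card {k. is_evil k \<and> k < m}"
proof (induction m)
  case 0
  then show ?case by (simp add: shift_def digits_0 digit_value_def is_evil_def)
next
  case (Suc m)
  have "{k. is_evil k \<and> k < Suc m}
      = (if is_evil m then insert m {k. is_evil k \<and> k < m} else {k. is_evil k \<and> k < m})"
    by (auto simp: less_Suc_eq)
  then have "card {k. is_evil k \<and> k < Suc m}
      = card {k. is_evil k \<and> k < m} + (if is_evil m then 1 else 0)"
    by simp
  then show ?case using Suc shift_Suc[of m] is_evil_or_is_evil_Suc[of m]
    by (simp add: distrib_left split: if_splits)
qed

section \<open>The left shift as a map from evil to old numbers\<close>

lemma rep_shift: "rep (\<lambda>i. if i = 0 then 0 else digits m (i - 1)) (shift m)"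
proof -
  let ?d = "digits m" and ?e = "\<lambda>i. if i = 0 then 0 else digits m (i - 1)"
  have adm: "admissible ?d" using rep_digits unfolding rep_def by auto
  obtain n where n: "\<And>i. i \<ge> n \<Longrightarrow> ?d i = 0"
    using adm finite_support_bound unfolding admissible_def by blast
  have n': "?e i = 0" if "i \<ge> Suc n" for i using that n by auto
  have "?e i \<le> q" if "?e (Suc i) = r" for i
    using that adm by (cases i) (auto simp: admissible_def)
  then have "admissible ?e"
    using adm finite_supportI[of "Suc n" ?e, OF n'] by (auto simp: admissible_def)
  moreover have "digit_value U ?e = shift m"
  proof -
    have "digit_value U ?e = (\<Sum>i<Suc n. ?e i * U i)"
      using n' by (rule digit_value_eq_sum)
    also have "\<dots> = (\<Sum>i<n. ?d i * U (Suc i))"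
      unfolding sum.lessThan_Suc_shift by simp
    also have "\<dots> = shift m"
      unfolding shift_def using n by (rule digit_value_eq_sum[symmetric])
    finally show ?thesis .
  qed
  ultimately show ?thesis by (simp add: rep_def)
qed

lemma digits_shift: "digits (shift m) = (\<lambda>i. if i = 0 then 0 else digits m (i - 1))"
  using rep_shift by (rule digits_eqI)

lemma shift_0: "shift 0 = 0"
  by (simp add: shift_def digits_0 digit_value_def)

lemma shift_eq_0_iff: "shift m = 0 \<longleftrightarrow> m = 0"
proof
  assume "shift m = 0"
  then have "digits (shift m) (Suc i) = 0" for i by (simp add: digits_0)
  then have "digits m = (\<lambda>_. 0)" by (simp add: digits_shift fun_eq_iff)
  then show "m = 0" by (simp add: digits_eq_0_iff)
qed (simp add: shift_0)

text \<open>The lowest nonzero position rises by one, which flips its parity. Zero is excluded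
  because it is a fixed point of \<open>shift\<close>.\<close>

lemma is_evil_shift:
  assumes "m > 0"
  shows "is_evil (shift m) \<longleftrightarrow> \<not> is_evil m"
proof -
  have "\<exists>i. digits m i \<noteq> 0" using digits_eq_0_iff[of m] assms by auto
  then obtain j where "digits (shift m) (Suc j) \<noteq> 0" by (auto simp: digits_shift)
  then have "(LEAST i. digits (shift m) i \<noteq> 0) = Suc (LEAST i. digits (shift m) (Suc i) \<noteq> 0)"
    by (rule Least_Suc) (simp add: digits_shift)
  then show ?thesis using assms shift_eq_0_iff[of m] by (simp add: is_evil_def digits_shift)
qed

text \<open>Deleting the final zero preserves admissibility and inverts the left shift.\<close>

lemma shift_if_digit_0:
  assumes "digits m 0 = 0"
  obtains v where "m = shift v"
proof -
  let ?d = "digits m" and ?e = "\<lambda>i. digits m (Suc i)"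
  have adm: "admissible ?d" using rep_digits unfolding rep_def by auto
  obtain n where n: "\<And>i. i \<ge> n \<Longrightarrow> ?d i = 0"
    using adm finite_support_bound unfolding admissible_def by blast
  have "admissible ?e"
    using adm finite_supportI[of n ?e] n by (auto simp: admissible_def)
  then have "rep ?e (digit_value U ?e)" by (simp add: rep_def)
  then have e: "digits (digit_value U ?e) = ?e" by (rule digits_eqI)
  have "digits (shift (digit_value U ?e)) = digits m"
    unfolding digits_shift e using assms by (auto simp: fun_eq_iff)
  then show thesis by (intro that digits_inject) (rule sym)
qed

lemma not_is_evil_imp_shift:
  assumes "\<not> is_evil m"
  obtains v where "is_evil v" "m = shift v"
proof -
  have "digits m 0 = 0"
  proof (rule ccontr)
    assume "digits m 0 \<noteq> 0"
    then have "(LEAST i. digits m i \<noteq> 0) = 0" by (rule Least_eq_0)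
    then show False using assms by (simp add: is_evil_def)
  qed
  then obtain v where v: "m = shift v" by (rule shift_if_digit_0)
  \<comment> \<open>Otherwise \<open>m = shift 0 = 0\<close>, which counts as evil.\<close>
  moreover have "v > 0" using assms v shift_0 by (auto simp: is_evil_def intro: gr0I)
  ultimately show thesis using that is_evil_shift assms by blast
qed

section \<open>The enumeration of evil numbers and the mex recursion\<close>

definition V :: "nat \<Rightarrow> nat" where "V = enumerate {m. is_evil m}"

lemma is_evil_V: "is_evil (V n)"
  using enumerate_in_set[OF infinite_evil, of n] by (simp add: V_def)

lemma V_less_iff: "V m < V n \<longleftrightarrow> m < n"
  unfolding V_def by (rule enumerate_mono_iff) (rule infinite_evil)

lemma V_surj: "is_evil m \<Longrightarrow> \<exists>n. m = V n"
  unfolding V_def using enumerate_Ex[OF infinite_evil, of m] by auto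

text \<open>At an evil number the correction term vanishes, and exactly \<open>n\<close> evil
  numbers lie below \<open>V n\<close>.\<close>

lemma shift_V: "shift (V n) = s * V n + t * n"
  using shift_eq_card[of "V n"] is_evil_V[of n] enumerate_card_less[OF infinite_evil, of n]
  by (simp add: V_def)

text \<open>Evil numbers below \<open>V n\<close> are earlier values of \<open>V\<close>, and the
  remaining ones are shifts of such values; \<open>V n\<close> itself is neither.\<close>

lemma mex_V: "mex (V ` {..<n} \<union> (\<lambda>i. shift (V i)) ` {..<n}) = V n"
  unfolding mex_def
proof (rule Least_equality)
  have "V n \<noteq> V i" if "i < n" for i using V_less_iff[of i n] that by auto
  moreover have "V n \<noteq> shift (V i)" if "i < n" for i
  proof (cases "V i = 0")
    case True
    then show ?thesis using V_less_iff[of i n] that shift_0 by auto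
  next
    case False
    then have "\<not> is_evil (shift (V i))" using is_evil_shift[of "V i"] is_evil_V[of i] by simp
    then show ?thesis using is_evil_V[of n] by auto
  qed
  ultimately show "V n \<notin> V ` {..<n} \<union> (\<lambda>i. shift (V i)) ` {..<n}" by auto
next
  fix k assume k: "k \<notin> V ` {..<n} \<union> (\<lambda>i. shift (V i)) ` {..<n}"
  show "V n \<le> k"
  proof (rule ccontr)
    assume "\<not> V n \<le> k"
    then have less: "k < V n" by simp
    show False
    proof (cases "is_evil k")
      case True
      then obtain i where "k = V i" using V_surj by blast
      then show False using less k V_less_iff by auto
    next
      case False
      then obtain v where v: "is_evil v" "k = shift v" by (rule not_is_evil_imp_shift)
      then obtain i where i: "v = V i" using V_surj by blast
      \<comment> \<open>As \<open>s\<close> is positive, shifting never decreases a number, so the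
        preimage of \<open>k\<close> also has index below \<open>n\<close>.\<close>
      have "V i \<le> shift (V i)" unfolding shift_V using s_pos by (simp add: trans_le_add1)
      then have "V i < V n" using less v i by simp
      then show False using k v i V_less_iff by auto
    qed
  qed
qed

end

theorem theorem3:
  fixes s t q r :: nat
    and u :: "int \<Rightarrow> real"
    and V W A B :: "nat \<Rightarrow> nat"
  assumes "s > 0" and "t > 0"
    and "q = s - 1" and "r = s + t - 1"
    and "u (-1) = 1 / real s" and "u 0 = 1"
    and "\<And>n. n \<ge> 1 \<Longrightarrow> u n = real r * u (n - 1) + real s * u (n - 2)"
    and "\<And>n. V n = enumerate {m. evil q r u m} n"
    and "\<And>n. W n = (THE w. R q r u w = LR q r u (V n))"
    and "\<And>n. A n = mex (A ` {..<n} \<union> B ` {..<n})"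
    and "\<And>n. B n = s * A n + t * n"
  shows "(\<forall>m. \<exists>!d. represents q r u d m) \<and> (\<forall>n. (V n, W n) = (A n, B n))"
proof -
  interpret N: numeration s t using assms(1,2) by unfold_locales
  have u: "u (int n) = real (weight s t n)" for n
  proof (induction n rule: induct_nat_012)
    \<comment> \<open>Here \<open>u (-1) = 1 / s\<close> enters:
      \<open>u 1 = r + s * (1 / s) = s + t\<close>.\<close>
    case 1
    then show ?case using assms(1,2,4,5,6) assms(7)[of 1] by (simp add: of_nat_diff)
  next
    case (ge2 n)
    have "u (int (Suc (Suc n))) = real r * u (int (Suc n)) + real s * u (int n)"
      using assms(7)[of "int (Suc (Suc n))"] by (simp add: add.commute)
    then show ?case using ge2 assms(4) N.r_def by simp
  qed (use assms(6) in simp)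
  have "(\<Sum>i | d i \<noteq> 0. real (d i) * u (int i)) = real (digit_value (weight s t) d)" for d
    by (simp add: u digit_value_def)
  then have rep: "represents q r u d m \<longleftrightarrow> N.rep d m" for d m
    unfolding represents_def N.rep_def N.admissible_def N.q_def N.r_def assms(3,4) by auto
  have R: "R q r u m = N.digits m" for m
    by (simp add: R_def N.digits_def rep)
  have V: "V = N.V"
    using assms(8) by (auto simp: N.V_def evil_def N.is_evil_def R)
  \<comment> \<open>This reduces the definite description of \<open>W n\<close> to
    \<open>THE w. w = N.shift (V n)\<close>.\<close>
  have digits_W: "N.digits w = N.digits (N.shift m) \<longleftrightarrow> w = N.shift m" for w m
    using N.digits_inject by blast
  have W: "W n = N.shift (V n)" for n
    unfolding assms(9) LR_def R N.digits_shift[symmetric] digits_W by simp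
  have "A n = V n" for n
  proof (induction n rule: less_induct)
    case (less n)
    \<comment> \<open>Agreement of \<open>A\<close> with \<open>V\<close> below \<open>n\<close>
      carries over to \<open>B\<close> because \<open>N.shift_V\<close> has the form of the
      recursion for \<open>B\<close>.\<close>
    then have "A ` {..<n} = N.V ` {..<n}" "B ` {..<n} = (\<lambda>i. N.shift (N.V i)) ` {..<n}"
      by (auto simp: assms(11) N.shift_V V)
    then show ?case using assms(10)[of n] N.mex_V[of n] V by simp
  qed
  then have "(V n, W n) = (A n, B n)" for n
    using assms(11)[of n] W[of n] N.shift_V[of n] V by simp
  then show ?thesis using N.ex1_rep rep by simp
qed

end
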